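(* Let $A\in\mathbb{R}^{n\times n}$ be symmetric positive definite with spectral decomposition $A=V\Lambda V^T+V_\perp\Lambda_\perp V_\perp^T$, where $(V,V_\perp)$ is an orthogonal matrix, $V\in\mathbb{R}^{n\times r}$, $\Lambda=\mathrm{diag}(\lambda_1,\dots,\lambda_r)$, $\Lambda_\perp=\mathrm{diag}(\lambda_{r+1},\dots,\lambda_n)$, $1\le r<n$, and every diagonal entry of $\Lambda$ is at most every diagonal entry of $\Lambda_\perp$. Let $\tilde E=V^TAV$ and let $\tilde H\in\mathbb{R}^{r\times r}$ be an invertible matrix. Let $\bar P_C=I+V\tilde H^{-1}V^T$ and $\rho=\tilde H^{-1}\tilde E-I$. If the eigenvalues of $\bar P_CA$ are real, then $$\lambda_{\max}(\bar P_CA)\le\max\{1+\lambda_{\max}(\Lambda),\lambda_{\max}(\Lambda_\perp)\}+\xi_C,$$ $$\lambda_{\min}(\bar P_CA)\ge\min\{1+\lambda_{\min}(\Lambda),\lambda_{\min}(\Lambda_\perp)\}-\xi_C,$$ where $\xi_C=\|\rho\|_2$.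
   Context: $\|\cdot\|_2$ is the spectral norm; $\lambda_{\min}$ and $\lambda_{\max}$ denote the smallest and largest eigenvalues of a matrix with real eigenvalues. The matrix $\tilde H$ is thought of as an approximation to $\tilde E$. *)

theory Defs
  imports "Jordan_Normal_Form.Spectral_Radius" "Jordan_Normal_Form.Gauss_Jordan_Elimination"
begin

definition symmetric_matrix :: "real mat \<Rightarrow> bool" where
  "symmetric_matrix A \<longleftrightarrow> square_mat A \<and> A\<^sup>T = A"

definition pos_definite :: "real mat \<Rightarrow> bool" where
  "pos_definite A \<longleftrightarrow>
     (\<forall>x \<in> carrier_vec (dim_col A). x \<noteq> 0\<^sub>v (dim_col A) \<longrightarrow> 0 < x \<bullet> (A *\<^sub>v x))"

definition join_cols :: "'a::zero mat \<Rightarrow> 'a mat \<Rightarrow> 'a mat" where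
  "join_cols A B = four_block_mat A B (0\<^sub>m 0 (dim_col A)) (0\<^sub>m 0 (dim_col B))"

(* The library's orthogonal_mat only asks for pairwise orthogonal nonzero columns. *)
definition orthogonal_matrix :: "real mat \<Rightarrow> bool" where
  "orthogonal_matrix Q \<longleftrightarrow> square_mat Q \<and> inverts_mat Q\<^sup>T Q \<and> inverts_mat Q Q\<^sup>T"

(* The library's mat_inverse returns an option; it is None only for singular matrices. *)
definition mat_inv :: "'a::field mat \<Rightarrow> 'a mat" where
  "mat_inv A = the (mat_inverse A)"

definition vec_norm2 :: "real vec \<Rightarrow> real" where
  "vec_norm2 v = sqrt (v \<bullet> v)"

(* Operator norm induced by the Euclidean norm. *)
definition spectral_norm :: "real mat \<Rightarrow> real" where
  "spectral_norm M = (SUP v \<in> {v \<in> carrier_vec (dim_col M). vec_norm2 v \<le> 1}. vec_norm2 (M *\<^sub>v v))"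

(* "The eigenvalues are real" is about complex eigenvalues: over the reals it would be vacuous. *)
definition real_eigenvalues :: "real mat \<Rightarrow> bool" where
  "real_eigenvalues M \<longleftrightarrow> spectrum (map_mat complex_of_real M) \<subseteq> \<real>"

(* These range over the real eigenvalues, so they are the extreme eigenvalues only for
   nonempty square matrices M satisfying real_eigenvalues M. *)
definition lambda_max :: "real mat \<Rightarrow> real" where
  "lambda_max M = Max (spectrum M)"

definition lambda_min :: "real mat \<Rightarrow> real" where
  "lambda_min M = Min (spectrum M)"

end

theory Submission
  imports Defs "HOL-Analysis.L2_Norm"
begin

text \<open>
  Multiplying \<open>P A x = \<mu> x\<close> by \<open>V\<^sup>T\<close> and by \<open>V\<^sub>\<bottom>\<^sup>T\<close> decouples the eigenvalue equation:
  with \<open>y = V\<^sup>T x\<close> and \<open>z = V\<^sub>\<bottom>\<^sup>T x\<close> it becomes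
  \<open>\<Lambda> y + y + \<rho> y = \<mu> y\<close> and \<open>\<Lambda>\<^sub>\<bottom> z = \<mu> z\<close>, and \<open>y\<close>, \<open>z\<close> do not both vanish. If \<open>z \<noteq> 0\<close>, then \<open>\<mu>\<close> is an
  entry of \<open>\<Lambda>\<^sub>\<bottom>\<close>. Otherwise \<open>y \<noteq> 0\<close>, and taking the inner product with \<open>y\<close> bounds
  \<open>\<mu> - 1\<close> by the Rayleigh quotient of \<open>\<Lambda>\<close> at \<open>y\<close> up to \<open>\<bar>y \<bullet> \<rho> y\<bar> / \<parallel>y\<parallel>\<^sup>2 \<le> \<parallel>\<rho>\<parallel>\<^sub>2\<close>.
\<close>

section \<open>The Euclidean norm and the spectral norm\<close>

lemma vec_norm2_eq_L2_set: "vec_norm2 v = L2_set (($) v) {0..<dim_vec v}"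
  by (simp add: vec_norm2_def L2_set_def scalar_prod_def power2_eq_square)

lemma vec_norm2_nonneg: "0 \<le> vec_norm2 v"
  by (simp add: vec_norm2_eq_L2_set)

lemma vec_norm2_square: "(vec_norm2 v)\<^sup>2 = v \<bullet> v"
  by (simp add: vec_norm2_def scalar_prod_def sum_nonneg)

lemma vec_norm2_smult: "vec_norm2 (a \<cdot>\<^sub>v v) = \<bar>a\<bar> * vec_norm2 v"
proof -
  have "(a \<cdot>\<^sub>v v) \<bullet> (a \<cdot>\<^sub>v v) = a\<^sup>2 * (v \<bullet> v)"
    by (simp add: scalar_prod_def sum_distrib_left power2_eq_square mult_ac)
  then show ?thesis
    by (simp add: vec_norm2_def real_sqrt_mult)
qed

lemma scalar_prod_self_pos:
  fixes v :: "real vec"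
  assumes "v \<in> carrier_vec n" "v \<noteq> 0\<^sub>v n"
  shows "0 < v \<bullet> v"
  using conjugate_square_greater_0_vec[of v n] assms by (simp add: vec_conjugate_real)

lemma abs_scalar_prod_le_vec_norm2:
  assumes "dim_vec v = dim_vec w"
  shows "\<bar>v \<bullet> w\<bar> \<le> vec_norm2 v * vec_norm2 w"
proof -
  have "\<bar>v \<bullet> w\<bar> \<le> (\<Sum>i\<in>{0..<dim_vec w}. \<bar>v $ i\<bar> * \<bar>w $ i\<bar>)"
    unfolding scalar_prod_def by (rule order.trans[OF sum_abs]) (simp add: abs_mult)
  also have "\<dots> \<le> vec_norm2 v * vec_norm2 w"
    unfolding vec_norm2_eq_L2_set assms by (rule L2_set_mult_ineq)
  finally show ?thesis .
qed

text \<open>The supremum in \<open>spectral_norm\<close> is taken over a set of reals, so it is an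
  upper bound only once that set is known to be bounded. Cauchy-Schwarz on each row supplies a
  bound: the sum of the Euclidean norms of the rows.\<close>

lemma bdd_above_vec_norm2_unit_ball:
  "bdd_above ((\<lambda>v. vec_norm2 (M *\<^sub>v v)) ` {v \<in> carrier_vec (dim_col M). vec_norm2 v \<le> 1})"
proof (rule bdd_aboveI2)
  fix v assume v: "v \<in> {v \<in> carrier_vec (dim_col M). vec_norm2 v \<le> 1}"
  have "vec_norm2 (M *\<^sub>v v) \<le> (\<Sum>i<dim_row M. \<bar>row M i \<bullet> v\<bar>)"
    unfolding vec_norm2_eq_L2_set
    by (rule order.trans[OF L2_set_le_sum_abs]) (simp add: atLeast0LessThan)
  also have "\<dots> \<le> (\<Sum>i<dim_row M. vec_norm2 (row M i))"
  proof (rule sum_mono)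
    fix i assume "i \<in> {..<dim_row M}"
    have "\<bar>row M i \<bullet> v\<bar> \<le> vec_norm2 (row M i) * vec_norm2 v"
      using v by (intro abs_scalar_prod_le_vec_norm2) auto
    also have "\<dots> \<le> vec_norm2 (row M i)"
      using v by (simp add: mult_left_le vec_norm2_nonneg)
    finally show "\<bar>row M i \<bullet> v\<bar> \<le> vec_norm2 (row M i)" .
  qed
  finally show "vec_norm2 (M *\<^sub>v v) \<le> (\<Sum>i<dim_row M. vec_norm2 (row M i))" .
qed

lemma vec_norm2_mult_mat_vec_le_unit:
  assumes "v \<in> carrier_vec (dim_col M)" "vec_norm2 v \<le> 1"
  shows "vec_norm2 (M *\<^sub>v v) \<le> spectral_norm M"
  unfolding spectral_norm_def
  using assms by (intro cSUP_upper bdd_above_vec_norm2_unit_ball) auto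

lemma spectral_norm_nonneg: "0 \<le> spectral_norm M"
proof -
  have "0 \<le> vec_norm2 (M *\<^sub>v 0\<^sub>v (dim_col M))"
    by (rule vec_norm2_nonneg)
  also have "\<dots> \<le> spectral_norm M"
    by (rule vec_norm2_mult_mat_vec_le_unit) (simp_all add: vec_norm2_def)
  finally show ?thesis .
qed

text \<open>Normalising \<open>v\<close> to a unit vector \<open>u\<close> reduces this to the unit
  ball; homogeneity of the norm scales the estimate back.\<close>

lemma vec_norm2_mult_mat_vec_le:
  assumes v: "v \<in> carrier_vec (dim_col M)" and "v \<noteq> 0\<^sub>v (dim_col M)"
  shows "vec_norm2 (M *\<^sub>v v) \<le> spectral_norm M * vec_norm2 v"
proof -
  have pos: "0 < vec_norm2 v"
    using scalar_prod_self_pos[OF assms] by (simp add: vec_norm2_def)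
  define u where "u = (1 / vec_norm2 v) \<cdot>\<^sub>v v"
  have "vec_norm2 (M *\<^sub>v u) \<le> spectral_norm M"
    using v pos by (intro vec_norm2_mult_mat_vec_le_unit) (auto simp: u_def vec_norm2_smult)
  moreover have "M *\<^sub>v u = (1 / vec_norm2 v) \<cdot>\<^sub>v (M *\<^sub>v v)"
    using v unfolding u_def by (intro mult_mat_vec) auto
  ultimately show ?thesis
    using pos by (simp add: vec_norm2_smult field_simps)
qed

text \<open>Cauchy-Schwarz followed by the operator norm estimate. This controls the quadratic form
  of \<rho>, which is in general not symmetric.\<close>

lemma abs_scalar_prod_mult_mat_vec_le:
  assumes M: "M \<in> carrier_mat n n" and v: "v \<in> carrier_vec n" "v \<noteq> 0\<^sub>v n"
  shows "\<bar>v \<bullet> (M *\<^sub>v v)\<bar> \<le> spectral_norm M * (v \<bullet> v)"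
proof -
  have "\<bar>v \<bullet> (M *\<^sub>v v)\<bar> \<le> vec_norm2 v * vec_norm2 (M *\<^sub>v v)"
    using M v by (intro abs_scalar_prod_le_vec_norm2) auto
  also have "\<dots> \<le> vec_norm2 v * (spectral_norm M * vec_norm2 v)"
    using M v by (intro mult_left_mono vec_norm2_mult_mat_vec_le vec_norm2_nonneg) auto
  also have "\<dots> = spectral_norm M * (v \<bullet> v)"
    by (simp add: vec_norm2_square[symmetric] power2_eq_square mult_ac)
  finally show ?thesis .
qed

section \<open>Diagonal matrices\<close>

lemma mat_diag_mult_vec:
  assumes "v \<in> carrier_vec n"
  shows "mat_diag n f *\<^sub>v v = vec n (\<lambda>i. f i * v $ i)"
proof (rule eq_vecI)
  fix i assume i: "i < dim_vec (vec n (\<lambda>i. f i * v $ i))"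
  then have "(mat_diag n f *\<^sub>v v) $ i = (\<Sum>j\<in>{0..<n}. (if i = j then f j else 0) * v $ j)"
    using assms by (auto simp: mat_diag_def scalar_prod_def intro!: sum.cong)
  also have "\<dots> = (\<Sum>j\<in>{0..<n}. if j = i then f i * v $ i else 0)"
    by (rule sum.cong) auto
  also have "\<dots> = f i * v $ i"
    using i by simp
  finally show "(mat_diag n f *\<^sub>v v) $ i = vec n (\<lambda>i. f i * v $ i) $ i"
    using i by simp
qed (simp add: mat_diag_def)

lemma mem_spectrum_mat_diag:
  fixes f :: "nat \<Rightarrow> 'a::field"
  assumes "i < n"
  shows "f i \<in> spectrum (mat_diag n f)"
proof -
  have "mat_diag n f *\<^sub>v unit_vec n i = f i \<cdot>\<^sub>v unit_vec n i"
    using assms by (subst mat_diag_mult_vec) (auto simp: unit_vec_def)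
  moreover have "unit_vec n i \<noteq> (0\<^sub>v n :: 'a vec)"
    using assms by (metis index_unit_vec(1) index_zero_vec(1) one_neq_zero)
  ultimately show ?thesis
    unfolding spectrum_def eigenvalue_def eigenvector_def mem_Collect_eq
    using assms by (intro exI[of _ "unit_vec n i"]) (auto simp: mat_diag_def)
qed

text \<open>Each entry lies in the spectrum, with a unit vector as eigenvector, and the spectrum is
  finite, so its \<open>Min\<close> and \<open>Max\<close> bracket the entry.\<close>

lemma lambda_mat_diag_bounds:
  assumes "i < n"
  shows "lambda_min (mat_diag n f) \<le> f i" "f i \<le> lambda_max (mat_diag n f)"
  unfolding lambda_min_def lambda_max_def
  using mem_spectrum_mat_diag[OF assms] card_finite_spectrum(1)[OF mat_diag_dim]
  by (auto intro: Min_le Max_ge)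

text \<open>The quadratic form is the sum of the squares of the coordinates weighted by the diagonal
  entries, so the bounds hold term by term.\<close>

lemma scalar_prod_mat_diag_bounds:
  fixes v :: "real vec"
  assumes v: "v \<in> carrier_vec n" and "\<And>i. i < n \<Longrightarrow> a \<le> f i" "\<And>i. i < n \<Longrightarrow> f i \<le> b"
  shows "a * (v \<bullet> v) \<le> v \<bullet> (mat_diag n f *\<^sub>v v)" "v \<bullet> (mat_diag n f *\<^sub>v v) \<le> b * (v \<bullet> v)"
proof -
  have form: "v \<bullet> (mat_diag n f *\<^sub>v v) = (\<Sum>i\<in>{0..<n}. f i * (v $ i * v $ i))"
    using v by (simp add: mat_diag_mult_vec scalar_prod_def mult.left_commute)
  have square: "v \<bullet> v = (\<Sum>i\<in>{0..<n}. v $ i * v $ i)"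
    using v by (simp add: scalar_prod_def)
  show "a * (v \<bullet> v) \<le> v \<bullet> (mat_diag n f *\<^sub>v v)"
    unfolding form square sum_distrib_left
    using assms by (auto intro!: sum_mono mult_right_mono)
  show "v \<bullet> (mat_diag n f *\<^sub>v v) \<le> b * (v \<bullet> v)"
    unfolding form square sum_distrib_left
    using assms by (auto intro!: sum_mono mult_right_mono)
qed

text \<open>At a coordinate where \<open>v\<close> does not vanish, the eigenvalue equation can be
  cancelled.\<close>

lemma eigenvalue_mat_diag:
  fixes f :: "nat \<Rightarrow> 'a::field"
  assumes v: "v \<in> carrier_vec n" "v \<noteq> 0\<^sub>v n" and eq: "mat_diag n f *\<^sub>v v = \<mu> \<cdot>\<^sub>v v"
  obtains i where "i < n" "\<mu> = f i"
proof -
  obtain i where i: "i < n" "v $ i \<noteq> 0"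
    using v by (metis carrier_vecD eq_vecI index_zero_vec)
  then have "f i * v $ i = \<mu> * v $ i"
    using arg_cong[OF eq, of "\<lambda>w. w $ i"] v by (simp add: mat_diag_mult_vec)
  with i that show thesis
    by auto
qed

lemma eigenvalue_perturbed_mat_diag_bounds:
  assumes R: "R \<in> carrier_mat n n" and y: "y \<in> carrier_vec n" "y \<noteq> 0\<^sub>v n"
    and eq: "(mat_diag n f + 1\<^sub>m n + R) *\<^sub>v y = \<mu> \<cdot>\<^sub>v y"
  shows "\<mu> \<le> 1 + lambda_max (mat_diag n f) + spectral_norm R"
    and "1 + lambda_min (mat_diag n f) - spectral_norm R \<le> \<mu>"
proof -
  let ?D = "mat_diag n f"
  have pos: "0 < y \<bullet> y"
    by (rule scalar_prod_self_pos[OF y])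
  have D: "?D \<in> carrier_mat n n"
    by simp
  have "(?D + 1\<^sub>m n + R) *\<^sub>v y = ?D *\<^sub>v y + y + R *\<^sub>v y"
    using D R y by (simp add: add_mult_distrib_mat_vec[of _ n n])
  \<comment> \<open>Pairing the eigenvalue equation with \<open>y\<close> turns it into an identity
    of real numbers; dividing by \<open>y \<bullet> y\<close> would give the Rayleigh
    quotients.\<close>
  then have "\<mu> * (y \<bullet> y) = y \<bullet> (?D *\<^sub>v y + y + R *\<^sub>v y)"
    unfolding eq[symmetric] using eq scalar_prod_smult_right[of y y \<mu>] by simp
  also have "\<dots> = y \<bullet> (?D *\<^sub>v y) + y \<bullet> y + y \<bullet> (R *\<^sub>v y)"
    using R y mult_mat_vec_carrier[OF D y(1)] mult_mat_vec_carrier[OF R y(1)]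
    by (simp add: scalar_prod_add_distrib[of _ n])
  finally have rq: "\<mu> * (y \<bullet> y) = y \<bullet> (?D *\<^sub>v y) + y \<bullet> y + y \<bullet> (R *\<^sub>v y)" .
  have D_bounds: "lambda_min ?D * (y \<bullet> y) \<le> y \<bullet> (?D *\<^sub>v y)"
      "y \<bullet> (?D *\<^sub>v y) \<le> lambda_max ?D * (y \<bullet> y)"
    using y(1) by (auto intro: scalar_prod_mat_diag_bounds lambda_mat_diag_bounds)
  note R_bound = abs_scalar_prod_mult_mat_vec_le[OF R y]
  have "\<mu> * (y \<bullet> y) \<le> (1 + lambda_max ?D + spectral_norm R) * (y \<bullet> y)"
    using rq D_bounds(2) R_bound by (simp add: distrib_right)
  then show "\<mu> \<le> 1 + lambda_max ?D + spectral_norm R"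
    using pos by simp
  have "(1 + lambda_min ?D - spectral_norm R) * (y \<bullet> y) \<le> \<mu> * (y \<bullet> y)"
    using rq D_bounds(1) R_bound by (simp add: distrib_right left_diff_distrib)
  then show "1 + lambda_min ?D - spectral_norm R \<le> \<mu>"
    using pos by simp
qed

section \<open>Block structure and inverses\<close>

text \<open>Since corresponding blocks have the same size, each block is recovered by shifting the
  indices by \<open>nr1\<close> and \<open>nc1\<close>.\<close>

lemma four_block_mat_eqD:
  assumes eq: "four_block_mat A B C D = four_block_mat A' B' C' D'"
    and "A \<in> carrier_mat nr1 nc1" "B \<in> carrier_mat nr1 nc2"
      "C \<in> carrier_mat nr2 nc1" "D \<in> carrier_mat nr2 nc2"
      "A' \<in> carrier_mat nr1 nc1" "B' \<in> carrier_mat nr1 nc2"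
      "C' \<in> carrier_mat nr2 nc1" "D' \<in> carrier_mat nr2 nc2"
  shows "A = A'" "B = B'" "C = C'" "D = D'"
proof -
  have entry: "four_block_mat A B C D $$ (i, j) = four_block_mat A' B' C' D' $$ (i, j)" for i j
    by (simp only: eq)
  show "A = A'"
  proof (rule eq_matI)
    fix i j assume "i < dim_row A'" "j < dim_col A'"
    then show "A $$ (i, j) = A' $$ (i, j)"
      using entry[of i j] assms(2-) by simp
  qed (use assms(2-) in auto)
  show "B = B'"
  proof (rule eq_matI)
    fix i j assume "i < dim_row B'" "j < dim_col B'"
    then show "B $$ (i, j) = B' $$ (i, j)"
      using entry[of i "nc1 + j"] assms(2-) by simp
  qed (use assms(2-) in auto)
  show "C = C'"
  proof (rule eq_matI)
    fix i j assume "i < dim_row C'" "j < dim_col C'"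
    then show "C $$ (i, j) = C' $$ (i, j)"
      using entry[of "nr1 + i" j] assms(2-) by simp
  qed (use assms(2-) in auto)
  show "D = D'"
  proof (rule eq_matI)
    fix i j assume "i < dim_row D'" "j < dim_col D'"
    then show "D $$ (i, j) = D' $$ (i, j)"
      using entry[of "nr1 + i" "nc1 + j"] assms(2-) by simp
  qed (use assms(2-) in auto)
qed

text \<open>With \<open>Q = join_cols V W\<close>, the first four identities are the blocks of
  \<open>Q\<^sup>T * Q = 1\<close>; the last one, the completeness relation, is
  \<open>Q * Q\<^sup>T = 1\<close>.\<close>

lemma orthogonal_join_colsD:
  assumes V: "V \<in> carrier_mat n r" and W: "W \<in> carrier_mat n s"
    and orth: "orthogonal_matrix (join_cols V W)"
  shows "V\<^sup>T * V = 1\<^sub>m r" "V\<^sup>T * W = 0\<^sub>m r s" "W\<^sup>T * V = 0\<^sub>m s r" "W\<^sup>T * W = 1\<^sub>m s"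
    and "V * V\<^sup>T + W * W\<^sup>T = 1\<^sub>m n"
proof -
  let ?Z = "0\<^sub>m 0 r :: real mat" and ?Y = "0\<^sub>m 0 s :: real mat"
  have Q: "join_cols V W = four_block_mat V W ?Z ?Y"
    using V W by (auto simp: join_cols_def)
  have QT: "(join_cols V W)\<^sup>T = four_block_mat V\<^sup>T ?Z\<^sup>T W\<^sup>T ?Y\<^sup>T"
    unfolding Q by (rule transpose_four_block_mat[OF V W]) auto
  have VT: "V\<^sup>T \<in> carrier_mat r n" and WT: "W\<^sup>T \<in> carrier_mat s n"
    using V W by auto
  have "four_block_mat (1\<^sub>m r) (0\<^sub>m r s) (0\<^sub>m s r) (1\<^sub>m s) = (join_cols V W)\<^sup>T * join_cols V W"
    using orth V W by (simp add: orthogonal_matrix_def inverts_mat_def join_cols_def)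
  also have "\<dots> = four_block_mat (V\<^sup>T * V) (V\<^sup>T * W) (W\<^sup>T * V) (W\<^sup>T * W)"
    unfolding QT unfolding Q
    by (subst mult_four_block_mat[OF VT _ WT _ V W])
      (use V W mult_carrier_mat[OF VT V] mult_carrier_mat[OF VT W] mult_carrier_mat[OF WT V]
        mult_carrier_mat[OF WT W] in auto)
  finally have "four_block_mat (V\<^sup>T * V) (V\<^sup>T * W) (W\<^sup>T * V) (W\<^sup>T * W)
      = four_block_mat (1\<^sub>m r) (0\<^sub>m r s) (0\<^sub>m s r) (1\<^sub>m s)" ..
  from four_block_mat_eqD[OF this, of r r s s] V W
  show "V\<^sup>T * V = 1\<^sub>m r" "V\<^sup>T * W = 0\<^sub>m r s" "W\<^sup>T * V = 0\<^sub>m s r" "W\<^sup>T * W = 1\<^sub>m s"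
    by auto
  \<comment> \<open>The lower blocks of \<open>join_cols V W\<close> have no rows, so the product
    has empty outer blocks; the identity is padded to the same shape.\<close>
  have "four_block_mat (1\<^sub>m n) (0\<^sub>m n 0) (0\<^sub>m 0 n) (0\<^sub>m 0 0) = join_cols V W * (join_cols V W)\<^sup>T"
    using orth V W by (auto simp: orthogonal_matrix_def inverts_mat_def join_cols_def)
  also have "\<dots> = four_block_mat (V * V\<^sup>T + W * W\<^sup>T) (0\<^sub>m n 0) (0\<^sub>m 0 n) (0\<^sub>m 0 0)"
    unfolding QT unfolding Q
    by (subst mult_four_block_mat[OF V W _ _ VT _ WT]) (use V W in auto)
  finally have "four_block_mat (V * V\<^sup>T + W * W\<^sup>T) (0\<^sub>m n 0) (0\<^sub>m 0 n) (0\<^sub>m 0 0)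
      = four_block_mat (1\<^sub>m n) (0\<^sub>m n 0) (0\<^sub>m 0 n) (0\<^sub>m 0 0)" ..
  from four_block_mat_eqD(1)[OF this, of n n 0 0] V W show "V * V\<^sup>T + W * W\<^sup>T = 1\<^sub>m n"
    by auto
qed

text \<open>\<open>mat_inv\<close> applies \<open>the\<close>, so its value is known only after
  \<open>None\<close> is excluded. For this the inverse \<open>B\<close> provided by invertibility
  must make \<open>H\<close> a unit of the matrix ring; the dimensions of \<open>B\<close> are read
  off from the two product identities.\<close>

lemma mat_inv_carrier:
  fixes H :: "'a::field mat"
  assumes H: "H \<in> carrier_mat n n" and inv: "invertible_mat H"
  shows "mat_inv H \<in> carrier_mat n n"
proof -
  obtain B where B: "H * B = 1\<^sub>m n" "B * H = 1\<^sub>m (dim_row B)"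
    using inv H unfolding invertible_mat_def inverts_mat_def by auto
  have "dim_col B = n"
    using arg_cong[OF B(1), of dim_col] by simp
  moreover have "dim_row B = n"
    using arg_cong[OF B(2), of dim_col] H by simp
  ultimately have "H \<in> Units (ring_mat TYPE('a) n ())"
    using H B unfolding Units_def ring_mat_def by auto
  then have "mat_inverse H \<noteq> None"
    using mat_inverse(1)[OF H, of "()"] by auto
  then show ?thesis
    using mat_inverse(2)[OF H] unfolding mat_inv_def by auto
qed

section \<open>Eigenvalues\<close>

text \<open>Needed because \<open>Max\<close> and \<open>Min\<close> are meaningful only on nonempty
  sets. The complexified matrix has an eigenvalue, which is real by assumption.\<close>

lemma real_spectrum_non_empty:
  assumes M: "M \<in> carrier_mat n n" and "0 < n" and "real_eigenvalues M"
  shows "spectrum M \<noteq> {}"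
proof -
  let ?C = "map_mat complex_of_real M"
  have C: "?C \<in> carrier_mat n n"
    using M by simp
  obtain k where k: "k \<in> spectrum ?C"
    using spectrum_non_empty[OF C \<open>0 < n\<close>] by blast
  with assms(3) obtain a where a: "k = complex_of_real a"
    unfolding real_eigenvalues_def by (auto elim: Reals_cases)
  \<comment> \<open>The characteristic polynomial commutes with the embedding of the reals, so a
    real root of the complex polynomial is a root of the real one.\<close>
  have "poly (map_poly complex_of_real (char_poly M)) (complex_of_real a) = 0"
    using k unfolding a spectrum_root_char_poly[OF C] of_real_hom.char_poly_hom[OF M] by simp
  then have "a \<in> spectrum M"
    unfolding spectrum_root_char_poly[OF M] by simp
  then show ?thesis
    by blast
qed

theorem theorem4p2:
  fixes n r :: nat
    and A V Vp L Lp E H P \<rho> :: "real mat"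
    and l :: "nat \<Rightarrow> real"
    and \<xi> :: real
  assumes "1 \<le> r" and "r < n"
    and "A \<in> carrier_mat n n"
    and "symmetric_matrix A" and "pos_definite A"
    and "V \<in> carrier_mat n r" and "Vp \<in> carrier_mat n (n - r)"
    and "orthogonal_matrix (join_cols V Vp)"
    and "L = mat_diag r l" and "Lp = mat_diag (n - r) (\<lambda>i. l (r + i))"
    and "A = V * L * V\<^sup>T + Vp * Lp * Vp\<^sup>T"
    and "\<forall>i < r. \<forall>j. r \<le> j \<and> j < n \<longrightarrow> l i \<le> l j"
    and "E = V\<^sup>T * A * V"
    and "H \<in> carrier_mat r r" and "invertible_mat H"
    and "P = 1\<^sub>m n + V * mat_inv H * V\<^sup>T"
    and "\<rho> = mat_inv H * E - 1\<^sub>m r"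
    and "\<xi> = spectral_norm \<rho>"
    and "real_eigenvalues (P * A)"
  shows "lambda_max (P * A) \<le> max (1 + lambda_max L) (lambda_max Lp) + \<xi>
    \<and> lambda_min (P * A) \<ge> min (1 + lambda_min L) (lambda_min Lp) - \<xi>"
proof -
  note V = assms(6) and W = assms(7)
  note orth = orthogonal_join_colsD[OF V W assms(8)]
  define s where "s = n - r"
  define G where "G = mat_inv H"
  have G: "G \<in> carrier_mat r r"
    unfolding G_def by (rule mat_inv_carrier) fact+
  have W: "Vp \<in> carrier_mat n s"
    using W by (simp add: s_def)
  note orth = orth[folded s_def]
  have VT: "V\<^sup>T \<in> carrier_mat r n" and WT: "Vp\<^sup>T \<in> carrier_mat s n"
    using V W by auto
  have L: "L \<in> carrier_mat r r" and Lp: "Lp \<in> carrier_mat s s"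
    by (simp_all add: assms(9,10) s_def)
  note A = assms(3)
  have cs: "V * L * V\<^sup>T \<in> carrier_mat n n" "Vp * Lp * Vp\<^sup>T \<in> carrier_mat n n"
    using V W L Lp by auto
  \<comment> \<open>Orthonormality of the columns of \<open>V\<close> and their orthogonality to
    those of \<open>Vp\<close> leave only the \<open>L\<close> term.\<close>
  have VTA: "V\<^sup>T * A = L * V\<^sup>T"
  proof -
    have "V\<^sup>T * A = V\<^sup>T * (V * L * V\<^sup>T) + V\<^sup>T * (Vp * Lp * Vp\<^sup>T)"
      unfolding assms(11) by (rule mult_add_distrib_mat[OF VT cs])
    also have "V\<^sup>T * (V * L * V\<^sup>T) = (V\<^sup>T * V) * (L * V\<^sup>T)"
      using V L VT by (simp add: assoc_mult_mat[of _ r n _ r _ n] assoc_mult_mat[of _ n r _ r _ n])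
    also have "V\<^sup>T * (Vp * Lp * Vp\<^sup>T) = (V\<^sup>T * Vp) * (Lp * Vp\<^sup>T)"
      using VT W Lp WT by (simp add: assoc_mult_mat[of _ r n _ s _ n] assoc_mult_mat[of _ n s _ s _ n])
    finally show ?thesis
      using L Lp VT WT by (simp add: orth left_mult_zero_mat[of _ s n])
  qed
  have WTA: "Vp\<^sup>T * A = Lp * Vp\<^sup>T"
  proof -
    have "Vp\<^sup>T * A = Vp\<^sup>T * (V * L * V\<^sup>T) + Vp\<^sup>T * (Vp * Lp * Vp\<^sup>T)"
      unfolding assms(11) by (rule mult_add_distrib_mat[OF WT cs])
    also have "Vp\<^sup>T * (V * L * V\<^sup>T) = (Vp\<^sup>T * V) * (L * V\<^sup>T)"
      using V L VT WT by (simp add: assoc_mult_mat[of _ s n _ r _ n] assoc_mult_mat[of _ n r _ r _ n])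
    also have "Vp\<^sup>T * (Vp * Lp * Vp\<^sup>T) = (Vp\<^sup>T * Vp) * (Lp * Vp\<^sup>T)"
      using W Lp WT by (simp add: assoc_mult_mat[of _ s n _ s _ n] assoc_mult_mat[of _ n s _ s _ n])
    finally show ?thesis
      using L Lp VT WT by (simp add: orth left_mult_zero_mat[of _ r n])
  qed
  \<comment> \<open>Hence \<open>G * L\<close> equals the identity plus \<rho>, which is how \<rho>
    enters the decoupled equation.\<close>
  have E: "E = L"
    using V VT L by (simp add: assms(13) VTA assoc_mult_mat[of _ r r _ n _ r] orth)
  have rho: "\<rho> = G * L - 1\<^sub>m r" and R: "\<rho> \<in> carrier_mat r r"
    using G L by (auto simp: assms(17) E G_def)
  have PA: "P * A = A + V * (G * (L * V\<^sup>T))"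
  proof -
    have "P * A = A + V * G * V\<^sup>T * A"
      unfolding assms(16) G_def[symmetric] using A V G VT
      by (subst add_mult_distrib_mat[of _ n n]) auto
    also have "V * G * V\<^sup>T * A = V * (G * (V\<^sup>T * A))"
      using A V G VT
      by (simp add: assoc_mult_mat[of _ n r _ n _ n] assoc_mult_mat[of _ n r _ r _ n])
    finally show ?thesis
      unfolding VTA .
  qed
  have K: "G * (L * V\<^sup>T) \<in> carrier_mat r n" and VK: "V * (G * (L * V\<^sup>T)) \<in> carrier_mat n n"
    using G L V VT by auto
  have PAc: "P * A \<in> carrier_mat n n"
    unfolding PA using A VK by simp
  \<comment> \<open>\<open>V\<^sup>T * V = 1\<close> strips the factor \<open>V\<close> from the
    correction term, leaving \<open>G * L\<close> next to \<open>L\<close>; this is the source of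
    the shift by 1 in the bounds.\<close>
  have VTPA: "V\<^sup>T * (P * A) = (L + 1\<^sub>m r + \<rho>) * V\<^sup>T"
  proof -
    have "V\<^sup>T * (P * A) = L * V\<^sup>T + G * (L * V\<^sup>T)"
      unfolding PA mult_add_distrib_mat[OF VT A VK] VTA
      using K by (simp add: assoc_mult_mat[OF VT V K, symmetric] orth left_mult_one_mat[OF K])
    also have "\<dots> = (L + G * L) * V\<^sup>T"
      using G L VT by (simp add: add_mult_distrib_mat[of _ r r] assoc_mult_mat[of _ r r _ r _ n])
    also have "L + G * L = L + 1\<^sub>m r + \<rho>"
      unfolding rho using L G by (intro eq_matI) auto
    finally show ?thesis .
  qed
  \<comment> \<open>Here the correction term vanishes, because
    \<open>Vp\<^sup>T * V = 0\<close>.\<close>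
  have WTPA: "Vp\<^sup>T * (P * A) = Lp * Vp\<^sup>T"
    unfolding PA mult_add_distrib_mat[OF WT A VK] WTA
    using K Lp WT by (simp add: assoc_mult_mat[OF WT V K, symmetric] orth left_mult_zero_mat[OF K])
  \<comment> \<open>When \<open>z\<close> is nonzero, the bounds hold even without \<xi>;
    nonnegativity allows it to be added.\<close>
  have \<xi>: "0 \<le> \<xi>"
    by (simp add: assms(18) spectral_norm_nonneg)
  have bounds: "\<mu> \<le> max (1 + lambda_max L) (lambda_max Lp) + \<xi>
      \<and> min (1 + lambda_min L) (lambda_min Lp) - \<xi> \<le> \<mu>" if \<mu>: "\<mu> \<in> spectrum (P * A)" for \<mu>
  proof -
    obtain x where x: "x \<in> carrier_vec n" "x \<noteq> 0\<^sub>v n" and ev: "P * A *\<^sub>v x = \<mu> \<cdot>\<^sub>v x"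
      using \<mu> unfolding spectrum_def eigenvalue_def eigenvector_def mem_Collect_eq
        carrier_matD(1)[OF PAc] by blast
    define y where "y = V\<^sup>T *\<^sub>v x"
    define z where "z = Vp\<^sup>T *\<^sub>v x"
    have y: "y \<in> carrier_vec r" and z: "z \<in> carrier_vec s"
      unfolding y_def z_def using VT WT x by auto
    have "(L + 1\<^sub>m r + \<rho>) *\<^sub>v y = V\<^sup>T *\<^sub>v (P * A *\<^sub>v x)"
      unfolding y_def assoc_mult_mat_vec[OF VT PAc x(1), symmetric] VTPA
      using VT R x by (intro assoc_mult_mat_vec[symmetric]) auto
    then have y_eq: "(L + 1\<^sub>m r + \<rho>) *\<^sub>v y = \<mu> \<cdot>\<^sub>v y"
      unfolding ev y_def using mult_mat_vec[OF VT x(1)] by simp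
    have "Lp *\<^sub>v z = Vp\<^sup>T *\<^sub>v (P * A *\<^sub>v x)"
      unfolding z_def assoc_mult_mat_vec[OF WT PAc x(1), symmetric] WTPA
      by (rule assoc_mult_mat_vec[OF Lp WT x(1), symmetric])
    then have z_eq: "Lp *\<^sub>v z = \<mu> \<cdot>\<^sub>v z"
      unfolding ev z_def using mult_mat_vec[OF WT x(1)] by simp
    show ?thesis
    proof (cases "z = 0\<^sub>v s")
      case False
      obtain i where i: "i < s" "\<mu> = l (r + i)"
        using eigenvalue_mat_diag[OF z False, of "\<lambda>i. l (r + i)"] z_eq
        unfolding assms(10) s_def by blast
      have "lambda_min Lp \<le> \<mu>" "\<mu> \<le> lambda_max Lp"
        using lambda_mat_diag_bounds[OF i(1), of "\<lambda>i. l (r + i)"]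
        unfolding assms(10) s_def[symmetric] i(2) by auto
      then show ?thesis
        using \<xi> by linarith
    next
      case True
      \<comment> \<open>By the completeness relation \<open>x\<close> is
        \<open>V *\<^sub>v y + Vp *\<^sub>v z\<close>, so both components vanishing would force the
        eigenvector to be zero.\<close>
      have "y \<noteq> 0\<^sub>v r"
      proof
        assume "y = 0\<^sub>v r"
        have "x = (V * V\<^sup>T + Vp * Vp\<^sup>T) *\<^sub>v x"
          using x by (simp add: orth)
        also have "\<dots> = V *\<^sub>v y + Vp *\<^sub>v z"
          unfolding y_def z_def using V W VT WT x
          by (simp add: add_mult_distrib_mat_vec[of _ n n] assoc_mult_mat_vec[of _ n r _ n]
              assoc_mult_mat_vec[of _ n s _ n])
        also have "\<dots> = 0\<^sub>v n"
          unfolding \<open>y = 0\<^sub>v r\<close> True using V W by auto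
        finally show False
          using x by simp
      qed
      from eigenvalue_perturbed_mat_diag_bounds[OF R y this, of l \<mu>] y_eq
      show ?thesis
        unfolding assms(9,18) by linarith
    qed
  qed
  \<comment> \<open>On a finite nonempty spectrum \<open>Max\<close> and \<open>Min\<close> are
    attained, so the bounds for an arbitrary eigenvalue apply to them.\<close>
  have "finite (spectrum (P * A))" "spectrum (P * A) \<noteq> {}"
    using card_finite_spectrum(1)[OF PAc] real_spectrum_non_empty[OF PAc _ assms(19)] assms(2)
    by auto
  then have "lambda_max (P * A) \<in> spectrum (P * A)" "lambda_min (P * A) \<in> spectrum (P * A)"
    unfolding lambda_max_def lambda_min_def by (auto intro: Max_in Min_in)
  then show ?thesis
    using bounds by blast
qed

end
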